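(* Consider a network of finitely many switches running the two information-sharing rounds (Aggregation round followed by Consolidation round) described in the context, where every message is sent and delivered successfully exactly once and each local table contains no duplicate flow IDs. Then at the end of the two rounds the resulting table $\mathrm{GTopK}$ is identical in all switches: for any two switches $S_1,S_2$, every vector index $1\le i\le d$ and every cell index $1\le j\le s$, the cell $\mathrm{GTopK}_{S_1}^{i,j}$ and the cell $\mathrm{GTopK}_{S_2}^{i,j}$ have the same content (the same pair (ID, count), or both are empty). This holds regardless of the orders in which the individual switches process the messages they receive.
   Context: **Tables.** Fix integers $d,s\ge 1$ and hash functions $\mathrm{hash}_1,\dots,\mathrm{hash}_d$ from the set of flow IDs to $\{1,\dots,s\}$; the IDs form a totally ordered set, and $d$, $s$ and the hash functions are the same for all tables in all switches. A table $T$ consists of $d$ vectors of $s$ cells each; the cell with index $j$ of vector $i$ is denoted $T^{i,j}$ and is either empty or holds a pair $(T^{i,j}.ID,\,T^{i,j}.count)$ with a positive integer count. In every table, an ID stored in cell $(i,j)$ satisfies $\mathrm{hash}_i(T^{i,j}.ID)=j$. A subscript such as $T_S$ denotes the copy of the table in switch $S$. **Initial data.** Each switch $S$ has a local table $\mathrm{LTopK}_S$ in which no ID occurs in more than one cell (the content is otherwise arbitrary, and is fixed during the two rounds). **Aggregation round.** Each switch initializes $\mathrm{Sum}_S$ as a copy of $\mathrm{LTopK}_S$. Each switch sends every pair (ID, count) of its table $\mathrm{LTopK}$ to every other switch; each such message is delivered exactly once. When a switch receives a pair $(x,c)$: if $x$ is an ID stored in its local table, it adds $c$ to the count stored with $x$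 in $\mathrm{Sum}_S$; otherwise it does nothing. The IDs in $\mathrm{Sum}_S$ never change. **Consolidation round.** After all Aggregation messages are processed, $\mathrm{Sum}_S$ is fixed. Every switch starts with an empty table $\mathrm{GTopK}_S$ and processes, each exactly once and in an arbitrary order that may depend on the switch, all the pairs (ID, count) contained in the $\mathrm{Sum}$ tables of all switches (including its own). Each such pair is the initial content of a packet. Packets pass through the vectors $1,2,\dots,d$ in this order, and may be regarded as processed one after the other. At vector $i$, a packet currently carrying $(x,c)$ looks at the cell $\mathrm{GTopK}_S^{i,j}$ with $j=\mathrm{hash}_i(x)$: - if the cell is empty, $(x,c)$ is stored there and the packet's processing ends; - if the cell holds $(y,c')$ with $c>c'$, or with $c=c'$ and $x>y$, then $(x,c)$ is stored in the cell and the packet continues to vector $i+1$ carrying $(y,c')$; - if the cell holds exactly $(x,c)$, the packet's processing ends; - otherwise the cell is unchanged and the packet continues to vector $i+1$ carrying $(x,c)$. After vector $d$ the packet is discarded. *)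

theory Defs
  imports Main "HOL-Library.Multiset"
begin

text \<open>A table maps a vector index and a cell index to the content of that cell. Only the cells
  with vector index in \<open>{1..d}\<close> and cell index in \<open>{1..s}\<close> belong to the table; whatever a function has
  at other indices is irrelevant.\<close>

type_synonym 'id table = "nat \<Rightarrow> nat \<Rightarrow> ('id \<times> nat) option"

definition is_table :: "nat \<Rightarrow> nat \<Rightarrow> (nat \<Rightarrow> 'id \<Rightarrow> nat) \<Rightarrow> 'id table \<Rightarrow> bool" where
  "is_table d s hash T \<longleftrightarrow>
     (\<forall>i\<in>{1..d}. \<forall>j\<in>{1..s}. \<forall>x c. T i j = Some (x, c) \<longrightarrow> hash i x = j \<and> c > 0)"

definition no_duplicate_ids :: "nat \<Rightarrow> nat \<Rightarrow> 'id table \<Rightarrow> bool" where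
  "no_duplicate_ids d s T \<longleftrightarrow>
     (\<forall>i\<in>{1..d}. \<forall>j\<in>{1..s}. \<forall>i'\<in>{1..d}. \<forall>j'\<in>{1..s}. \<forall>x c c'.
        T i j = Some (x, c) \<longrightarrow> T i' j' = Some (x, c') \<longrightarrow> i = i' \<and> j = j')"

definition table_ids :: "nat \<Rightarrow> nat \<Rightarrow> 'id table \<Rightarrow> 'id set" where
  "table_ids d s T = {x. \<exists>i\<in>{1..d}. \<exists>j\<in>{1..s}. \<exists>c. T i j = Some (x, c)}"

text \<open>A multiset, because the same pair may be sent by several switches, and each of these
  messages is delivered.\<close>

definition table_pairs :: "nat \<Rightarrow> nat \<Rightarrow> 'id table \<Rightarrow> ('id \<times> nat) multiset" where
  "table_pairs d s T =
     (\<Sum>i\<in>{1..d}. \<Sum>j\<in>{1..s}. case T i j of None \<Rightarrow> {#} | Some p \<Rightarrow> {#p#})"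

definition empty_table :: "'id table" where
  "empty_table = (\<lambda>i j. None)"

definition set_cell :: "nat \<Rightarrow> nat \<Rightarrow> 'id \<times> nat \<Rightarrow> 'id table \<Rightarrow> 'id table" where
  "set_cell i j p T = T(i := (T i)(j := Some p))"

definition add_count :: "'id \<Rightarrow> nat \<Rightarrow> 'id table \<Rightarrow> 'id table" where
  "add_count x c T = (\<lambda>i j. case T i j of
       None \<Rightarrow> None
     | Some (y, c') \<Rightarrow> if y = x then Some (y, c' + c) else Some (y, c'))"

text \<open>Reception of one Aggregation message by a switch with local table \<open>L\<close>; the last argument
  is the current content of its Sum table.\<close>

fun aggregation_receive ::
  "nat \<Rightarrow> nat \<Rightarrow> 'id table \<Rightarrow> 'id \<times> nat \<Rightarrow> 'id table \<Rightarrow> 'id table" where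
  "aggregation_receive d s L (x, c) T = (if x \<in> table_ids d s L then add_count x c T else T)"

definition aggregate :: "nat \<Rightarrow> nat \<Rightarrow> 'id table \<Rightarrow> ('id \<times> nat) list \<Rightarrow> 'id table" where
  "aggregate d s L msgs = fold (aggregation_receive d s L) msgs L"

text \<open>The list argument contains the indices of the vectors the packet still has to visit.\<close>

fun pass_packet ::
  "(nat \<Rightarrow> 'id::linorder \<Rightarrow> nat) \<Rightarrow> nat list \<Rightarrow> 'id \<times> nat \<Rightarrow> 'id table \<Rightarrow> 'id table" where
  "pass_packet hash [] (x, c) T = T"
| "pass_packet hash (i # is) (x, c) T =
     (case T i (hash i x) of
        None \<Rightarrow> set_cell i (hash i x) (x, c) T
      | Some (y, c') \<Rightarrow>
          if c > c' \<or> (c = c' \<and> x > y)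
          then pass_packet hash is (y, c') (set_cell i (hash i x) (x, c) T)
          else if (y, c') = (x, c) then T
          else pass_packet hash is (x, c) T)"

definition consolidate ::
  "nat \<Rightarrow> (nat \<Rightarrow> 'id::linorder \<Rightarrow> nat) \<Rightarrow> ('id \<times> nat) list \<Rightarrow> 'id table" where
  "consolidate d hash packets = fold (pass_packet hash [1..<Suc d]) packets empty_table"

end

theory Submission
  imports Defs
begin

text \<open>The pairs are totally ordered by count and then by ID. When a set \<open>A\<close> of pairs has been fed into
  a vector, in any order and with any repetitions, every cell of the vector holds the greatest pair
  of \<open>A\<close> hashed to it, and the set of pairs passed on to the next vector consists exactly of the
  other pairs of \<open>A\<close>: repetitions of a pair are absorbed only while it is stored, and a pair that is
  not the greatest of its cell is displaced in the end. Thus \<open>GTopK\<close> depends only on the set of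
  processed packets, which is the same for all switches.\<close>

definition pair_le :: "'id::linorder \<times> nat \<Rightarrow> 'id \<times> nat \<Rightarrow> bool" where
  "pair_le p q \<longleftrightarrow> snd p < snd q \<or> snd p = snd q \<and> fst p \<le> fst q"

lemma pair_le_refl: "pair_le p p"
  by (simp add: pair_le_def)

lemma pair_le_trans: "pair_le p q \<Longrightarrow> pair_le q r \<Longrightarrow> pair_le p r"
  by (auto simp: pair_le_def)

lemma pair_le_antisym: "pair_le p q \<Longrightarrow> pair_le q p \<Longrightarrow> p = q"
  by (auto simp: pair_le_def prod_eq_iff)

text \<open>The right-hand side is the test by which \<open>pass_packet\<close> lets an arriving
  packet displace the stored pair.\<close>

lemma not_pair_le_iff: "\<not> pair_le (x, c) (y, c') \<longleftrightarrow> c > c' \<or> c = c' \<and> x > y"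
  by (auto simp: pair_le_def)

lemma pair_le_linear: "pair_le p q \<or> pair_le q p"
  by (auto simp: pair_le_def)

definition cell_pairs :: "('id \<Rightarrow> nat) \<Rightarrow> nat \<Rightarrow> ('id \<times> nat) set \<Rightarrow> ('id \<times> nat) set" where
  "cell_pairs h j A = {p \<in> A. h (fst p) = j}"

definition is_best :: "('id::linorder \<times> nat) set \<Rightarrow> ('id \<times> nat) option \<Rightarrow> bool" where
  "is_best A c = (case c of None \<Rightarrow> A = {} | Some p \<Rightarrow> p \<in> A \<and> (\<forall>q\<in>A. pair_le q p))"

text \<open>A pair counts only in the cell that its own ID hashes to. In a row satisfying
  \<open>settled\<close> every stored pair is of this kind, so this is the whole content of the
  row.\<close>

definition stored :: "(nat \<Rightarrow> ('id \<times> nat) option) \<Rightarrow> ('id \<Rightarrow> nat) \<Rightarrow> ('id \<times> nat) set" where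
  "stored V h = {p. V (h (fst p)) = Some p}"

text \<open>Here \<open>A\<close> is the set of pairs that have reached the first listed vector, and
  the recursive call receives those passed on to the next one. As \<open>j\<close> ranges over all
  naturals, cells to which no pair of \<open>A\<close> hashes must be empty.\<close>

fun settled ::
  "(nat \<Rightarrow> 'id::linorder \<Rightarrow> nat) \<Rightarrow> nat list \<Rightarrow> ('id \<times> nat) set \<Rightarrow> 'id table \<Rightarrow> bool" where
  "settled hash [] A T = True"
| "settled hash (i # is) A T \<longleftrightarrow>
     (\<forall>j. is_best (cell_pairs (hash i) j A) (T i j)) \<and>
     settled hash is (A - stored (T i) (hash i)) T"

lemma is_best_None: "is_best A None \<longleftrightarrow> A = {}"
  by (simp add: is_best_def)

lemma is_best_Some: "is_best A (Some p) \<longleftrightarrow> p \<in> A \<and> (\<forall>q\<in>A. pair_le q p)"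
  by (simp add: is_best_def)

lemma is_best_unique:
  assumes "is_best A c" "is_best A c'"
  shows "c = c'"
proof (cases c)
  case None
  with assms show ?thesis by (cases c') (auto simp: is_best_None is_best_Some)
next
  case (Some p)
  with assms obtain p' where p': "c' = Some p'"
    by (cases c') (auto simp: is_best_None is_best_Some)
  have "pair_le p p'" "pair_le p' p"
    using assms unfolding Some p' is_best_Some by blast+
  then show ?thesis
    using Some p' by (simp add: pair_le_antisym)
qed

text \<open>Greatest pairs are unique, so \<open>A\<close> determines the first row. Hence both
  tables pass on the same set, to which the induction hypothesis applies.\<close>

lemma settled_unique:
  "settled hash is A T \<Longrightarrow> settled hash is A T' \<Longrightarrow> i \<in> set is \<Longrightarrow> T i = T' i"
proof (induction "is" arbitrary: A)
  case (Cons k ks)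
  have "T k = T' k"
  proof
    fix j
    show "T k j = T' k j"
      using Cons.prems(1,2) by (auto intro: is_best_unique)
  qed
  with Cons show ?case by auto
qed simp

lemma settled_cong:
  "(\<And>i. i \<in> set is \<Longrightarrow> T i = T' i) \<Longrightarrow> settled hash is A T \<longleftrightarrow> settled hash is A T'"
  by (induction "is" arbitrary: A) auto

lemma settled_empty: "settled hash is {} empty_table"
  by (induction "is") (auto simp: is_best_def cell_pairs_def empty_table_def)

lemma pass_packet_other: "i \<notin> set is \<Longrightarrow> pass_packet hash is p T i = T i"
  by (induction "is" arbitrary: p T) (auto simp: set_cell_def split: option.splits prod.splits)

lemma cell_pairs_insert:
  "cell_pairs h j (insert p A) =
     (if h (fst p) = j then insert p (cell_pairs h j A) else cell_pairs h j A)"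
  by (auto simp: cell_pairs_def)

lemma set_cell_same: "set_cell i j p T i = (T i)(j := Some p)"
  by (simp add: set_cell_def)

lemma set_cell_other: "k \<noteq> i \<Longrightarrow> set_cell i j p T k = T k"
  by (simp add: set_cell_def)

lemma pass_packet_Cons:
  "pass_packet hash (i # is) p T =
     (case T i (hash i (fst p)) of
        None \<Rightarrow> set_cell i (hash i (fst p)) p T
      | Some q \<Rightarrow>
          if \<not> pair_le p q then pass_packet hash is q (set_cell i (hash i (fst p)) p T)
          else if q = p then T
          else pass_packet hash is p T)"
  by (cases p) (auto simp: not_pair_le_iff split: option.splits)

text \<open>Induction along the vectors. The packet \<open>p\<close> has to be generalized as well
  as \<open>A\<close> and \<open>T\<close>, since after a displacement the next vector receives the
  old content of the cell.\<close>

lemma settled_pass_packet: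
  assumes "distinct is" "settled hash is A T"
  shows "settled hash is (insert p A) (pass_packet hash is p T)"
  using assms
proof (induction "is" arbitrary: A T p)
  case (Cons i "is")
  define h where "h = hash i"
  define j where "j = h (fst p)"
  define R where "R = A - stored (T i) h"
  have i: "i \<notin> set is" and dist: "distinct is" using Cons.prems(1) by auto
  have best: "is_best (cell_pairs h k A) (T i k)" for k
    using Cons.prems(2) by (simp add: h_def)
  have rest: "settled hash is R T"
    using Cons.prems(2) by (simp add: R_def h_def)
  \<comment> \<open>The indices are distinct, so writing to vector \<open>i\<close> leaves the later
    vectors alone.\<close>
  have rest': "settled hash is R (set_cell i j p T)"
    using rest i settled_cong[of "is" T "set_cell i j p T"] by (metis set_cell_other)
  \<comment> \<open>Common pattern of the cases that change \<open>A\<close>: \<open>V\<close> is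
    the new row \<open>i\<close> and \<open>R'\<close> the new set of pairs passed on.\<close>
  have step: "settled hash (i # is) (insert p A) T'"
    if "T' i = V" "\<And>k. is_best (cell_pairs h k (insert p A)) (V k)"
      "insert p A - stored V h = R'" "settled hash is R' T'" for T' V R'
    using that by (simp add: h_def)
  show ?case
  proof (cases "T i j")
    case None
    then have empty: "cell_pairs h j A = {}"
      using best[of j] by (simp add: is_best_def)
    \<comment> \<open>The packet is absorbed by the empty cell, so nothing new is passed on.\<close>
    have "insert p A - stored ((T i)(j := Some p)) h = R"
      using None empty by (auto simp: R_def stored_def j_def cell_pairs_def)
    moreover have "is_best (cell_pairs h k (insert p A)) (((T i)(j := Some p)) k)" for k
      using best[of k] empty
      by (auto simp: cell_pairs_insert j_def is_best_def pair_le_refl)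
    ultimately show ?thesis
      using None rest' step[of "set_cell i j p T"]
      by (simp add: pass_packet_Cons h_def j_def set_cell_same del: settled.simps)
  next
    case (Some q)
    then have q: "q \<in> A" "h (fst q) = j" "\<And>r. r \<in> A \<Longrightarrow> h (fst r) = j \<Longrightarrow> pair_le r q"
      using best[of j] by (auto simp: is_best_def cell_pairs_def)
    consider "\<not> pair_le p q" | "q = p" | "pair_le p q" "q \<noteq> p" by blast
    then show ?thesis
    proof cases
      case 1
      \<comment> \<open>A pair of \<open>A\<close> hashed to \<open>j\<close> cannot exceed
        \<open>q\<close>. So \<open>p\<close> has not been passed on before, and the new set is
        exactly \<open>R\<close> with the displaced \<open>q\<close> added.\<close>
      have "p \<notin> A"
      proof
        assume "p \<in> A"
        from q(3)[OF this] 1 show False by (simp add: j_def)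
      qed
      have "pair_le q p" using 1 pair_le_linear by blast
      have "insert p A - stored ((T i)(j := Some p)) h = insert q R"
        using Some q 1 \<open>p \<notin> A\<close> by (auto simp: R_def stored_def j_def pair_le_refl)
      moreover have "is_best (cell_pairs h k (insert p A)) (((T i)(j := Some p)) k)" for k
      proof (cases "k = j")
        case True
        have "pair_le r p" if "r \<in> cell_pairs h j A" for r
          using that q(3)[of r] pair_le_trans[OF _ \<open>pair_le q p\<close>] by (simp add: cell_pairs_def)
        then show ?thesis
          using True by (simp add: cell_pairs_insert is_best_Some j_def pair_le_refl)
      next
        case False
        then show ?thesis
          using best[of k] by (auto simp: cell_pairs_insert j_def)
      qed
      moreover have "settled hash is (insert q R) (pass_packet hash is q (set_cell i j p T))"
        using Cons.IH[OF dist rest'] .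
      moreover have "pass_packet hash is q (set_cell i j p T) i = (T i)(j := Some p)"
        using i by (simp add: pass_packet_other set_cell_def fun_eq_iff)
      ultimately have
        "settled hash (i # is) (insert p A) (pass_packet hash is q (set_cell i j p T))"
        by (intro step)
      then show ?thesis
        using Some 1 by (simp add: pass_packet_Cons h_def j_def del: settled.simps)
    next
      case 2
      \<comment> \<open>The repeated pair is already in \<open>A\<close>, so neither the set nor the
        table changes.\<close>
      then show ?thesis
        using Some q(1) Cons.prems(2)
        by (simp add: pass_packet_Cons h_def j_def pair_le_refl insert_absorb
            del: settled.simps)
    next
      case 3
      \<comment> \<open>The row is unchanged and \<open>p\<close> moves on. If \<open>p\<close> was
        in \<open>A\<close> already, it is in \<open>R\<close> too, and the repetition leaves the
        set as it was.\<close>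
      have "insert p A - stored (T i) h = insert p R"
        using Some 3 by (auto simp: R_def stored_def j_def)
      moreover have "is_best (cell_pairs h k (insert p A)) (T i k)" for k
        using best[of k] Some 3(1) by (auto simp: cell_pairs_insert is_best_def j_def)
      moreover have "settled hash is (insert p R) (pass_packet hash is p T)"
        using Cons.IH[OF dist rest] .
      ultimately show ?thesis
        using Some 3 i step[of "pass_packet hash is p T"]
        by (simp add: pass_packet_Cons h_def j_def pass_packet_other del: settled.simps)
    qed
  qed
qed simp

lemma settled_fold_pass_packet:
  assumes "distinct is" "settled hash is A T"
  shows "settled hash is (set ps \<union> A) (fold (pass_packet hash is) ps T)"
  using assms(2)
proof (induction ps arbitrary: A T)
  case (Cons p ps)
  then show ?case
    using Cons.IH[OF settled_pass_packet[OF assms(1) Cons.prems]] by simp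
qed simp

text \<open>Both final tables are \<open>settled\<close> for the same set of packets, starting from
  the empty table and the empty set, so uniqueness applies row by row.\<close>

lemma consolidate_cong_set:
  assumes "set ps = set ps'" "i \<in> {1..d}"
  shows "consolidate d hash ps i = consolidate d hash ps' i"
proof -
  have "settled hash [1..<Suc d] (set qs) (consolidate d hash qs)" for qs
    unfolding consolidate_def
    using settled_fold_pass_packet[OF distinct_upt settled_empty] by (metis Un_empty_right)
  moreover have "i \<in> set [1..<Suc d]" using assms(2) by auto
  ultimately show ?thesis
    using assms(1) settled_unique by metis
qed

theorem theorem5p3:
  fixes d s :: nat
    and hash :: "nat \<Rightarrow> 'id::linorder \<Rightarrow> nat"
    and switches :: "'sw set"
    and LTopK Sum GTopK :: "'sw \<Rightarrow> 'id table"
    and agg_msgs cons_msgs :: "'sw \<Rightarrow> ('id \<times> nat) list"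
  assumes "d \<ge> 1" and "s \<ge> 1"
    and "\<And>i x. i \<in> {1..d} \<Longrightarrow> hash i x \<in> {1..s}"
    and "finite switches"
    and "\<And>S. S \<in> switches \<Longrightarrow> is_table d s hash (LTopK S)"
    and "\<And>S. S \<in> switches \<Longrightarrow> no_duplicate_ids d s (LTopK S)"
    and "\<And>S. S \<in> switches \<Longrightarrow>
           mset (agg_msgs S) = (\<Sum>S'\<in>switches - {S}. table_pairs d s (LTopK S'))"
    and "\<And>S. S \<in> switches \<Longrightarrow> Sum S = aggregate d s (LTopK S) (agg_msgs S)"
    and "\<And>S. S \<in> switches \<Longrightarrow>
           mset (cons_msgs S) = (\<Sum>S'\<in>switches. table_pairs d s (Sum S'))"
    and "\<And>S. S \<in> switches \<Longrightarrow> GTopK S = consolidate d hash (cons_msgs S)"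
  shows "\<forall>S1\<in>switches. \<forall>S2\<in>switches. \<forall>i\<in>{1..d}. \<forall>j\<in>{1..s}. GTopK S1 i j = GTopK S2 i j"
proof (intro ballI)
  fix S1 S2 i j
  assume S: "S1 \<in> switches" "S2 \<in> switches" and i: "i \<in> {1..d}"
  \<comment> \<open>The sum that describes the packets of a switch ranges over all switches, its own
    included, and so does not depend on the receiver.\<close>
  have "mset (cons_msgs S1) = mset (cons_msgs S2)"
    using S assms(9) by simp
  then have "set (cons_msgs S1) = set (cons_msgs S2)"
    by (rule mset_eq_setD)
  then show "GTopK S1 i j = GTopK S2 i j"
    using S i assms(10) consolidate_cong_set by metis
qed

end
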